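(* No mechanism simultaneously satisfies ex-ante favoring-eagerness-for-remaining-items (ea-FERI) and sd-envy-freeness (sd-EF).
   Context: Setting. An assignment problem has a set $N=\{1,\dots,n\}$ of agents and a set $M$ of $n$ items (one unit each). A preference profile $R=(\succ_j)_{j\in N}$ gives each agent $j$ a strict linear order $\succ_j$ on $M$. For nonempty $S\subseteq M$, $\mathrm{top}(j,S)$ is the $\succ_j$-best item of $S$. $U(\succ_j,o)=\{o'\in M:o'\succ_jo\}\cup\{o\}$. A random assignment is a doubly stochastic $n\times n$ matrix $P=[p_{j,o}]$ with rows $P_j$. A mechanism assigns to every preference profile (of every assignment problem, of any size $n$) a random assignment; it satisfies a property of random assignments if its output satisfies it for every profile. ea-FERI. Given $P$, put $M_{P,0}=\emptyset$ and $E_{P,0}(o)=\emptyset$ for all $o$. For $r=1,2,\dots$ define recursively $M_{P,r}=\{o\in M:\sum_{k\in\bigcup_{r'<r}E_{P,r'}(o)}p_{k,o}<1\}$ and, for $o\in M_{P,r}$, $E_{P,r}(o)=\{j\in N:o=\mathrm{top}(j,M_{P,r})\}$ (with $E_{P,r}(o)=\emptyset$ for $o\notin M_{P,r}$). $P$ satisfies ea-FERI if for every $r\ge1$, every $o\in M_{P,r}$ and every $j\in N$: if $j\in E_{P,r'}(o)$ for some $r'<r$, then $\sum_{o'\in U(\succ_j,o)}p_{j,o'}=1$. Stochastic dominance. For probability vectors $p,q$ on $M$, $p\succeq^{sd}_jq$ means $\sum_{o'\in U(\succ_j,o)}p_{o'}\ge\sum_{o'\in U(\succ_j,o)}q_{o'}$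 for all $o\in M$. sd-EF: $P$ is sd-EF if $P_j\succeq^{sd}_jP_k$ for all $j,k\in N$. *)

theory Defs
  imports Complex_Main "HOL-Library.FuncSet"
begin

text \<open>
  A preference is a strict linear order \<open>r \<subseteq> M \<times> M\<close>, where \<open>(x, y) \<in> r\<close> means that \<open>x\<close> is strictly
  preferred to \<open>y\<close>. The agents of a problem of size \<open>n\<close> are \<open>1, \<dots>, n\<close>. Outside \<open>{1..n}\<close> a profile
  is \<open>undefined\<close>, so that it carries no information beyond the preferences of the agents.
\<close>

definition assignment_problem :: "nat \<Rightarrow> 'o set \<Rightarrow> bool" where
  "assignment_problem n M \<longleftrightarrow> n \<ge> 1 \<and> finite M \<and> card M = n"

definition preference_profiles :: "nat \<Rightarrow> 'o set \<Rightarrow> (nat \<Rightarrow> 'o rel) set" where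
  "preference_profiles n M = {1..n} \<rightarrow>\<^sub>E {r. r \<subseteq> M \<times> M \<and> strict_linear_order_on M r}"

definition upper_set :: "'o set \<Rightarrow> 'o rel \<Rightarrow> 'o \<Rightarrow> 'o set" where
  "upper_set M r x = {y \<in> M. (y, x) \<in> r} \<union> {x}"

definition top_item :: "'o rel \<Rightarrow> 'o set \<Rightarrow> 'o" where
  "top_item r S = (THE x. x \<in> S \<and> (\<forall>y\<in>S. y \<noteq> x \<longrightarrow> (x, y) \<in> r))"

definition random_assignment :: "nat \<Rightarrow> 'o set \<Rightarrow> (nat \<Rightarrow> 'o \<Rightarrow> real) \<Rightarrow> bool" where
  "random_assignment n M P \<longleftrightarrow>
     (\<forall>j\<in>{1..n}. \<forall>x\<in>M. P j x \<ge> 0) \<and>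
     (\<forall>j\<in>{1..n}. (\<Sum>x\<in>M. P j x) = 1) \<and>
     (\<forall>x\<in>M. (\<Sum>j\<in>{1..n}. P j x) = 1)"

text \<open>\<open>remaining_items n M R P r\<close> is \<open>M\<^sub>P\<^sub>,\<^sub>r\<close> and \<open>eager_agents n M R P r x\<close> is \<open>E\<^sub>P\<^sub>,\<^sub>r(x)\<close>.\<close>

function remaining_items ::
    "nat \<Rightarrow> 'o set \<Rightarrow> (nat \<Rightarrow> 'o rel) \<Rightarrow> (nat \<Rightarrow> 'o \<Rightarrow> real) \<Rightarrow> nat \<Rightarrow> 'o set"
  and eager_agents ::
    "nat \<Rightarrow> 'o set \<Rightarrow> (nat \<Rightarrow> 'o rel) \<Rightarrow> (nat \<Rightarrow> 'o \<Rightarrow> real) \<Rightarrow> nat \<Rightarrow> 'o \<Rightarrow> nat set"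
where
  "remaining_items n M R P 0 = {}"
| "remaining_items n M R P (Suc r) =
     {x \<in> M. (\<Sum>k\<in>(\<Union>r'\<in>{..<Suc r}. eager_agents n M R P r' x). P k x) < 1}"
| "eager_agents n M R P r x =
     (if x \<in> remaining_items n M R P r
      then {j \<in> {1..n}. x = top_item (R j) (remaining_items n M R P r)}
      else {})"
  by pat_completeness auto
termination
  by (relation "measure (\<lambda>a. case a of
        Inl (n, M, R, P, r) \<Rightarrow> 2 * r
      | Inr (n, M, R, P, r, x) \<Rightarrow> 2 * r + 1)") auto

definition ea_FERI ::
    "nat \<Rightarrow> 'o set \<Rightarrow> (nat \<Rightarrow> 'o rel) \<Rightarrow> (nat \<Rightarrow> 'o \<Rightarrow> real) \<Rightarrow> bool" where
  "ea_FERI n M R P \<longleftrightarrow>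
     (\<forall>r\<ge>1. \<forall>x\<in>remaining_items n M R P r. \<forall>j\<in>{1..n}.
        (\<exists>r'<r. j \<in> eager_agents n M R P r' x) \<longrightarrow>
        (\<Sum>y\<in>upper_set M (R j) x. P j y) = 1)"

definition sd_dominates :: "'o set \<Rightarrow> 'o rel \<Rightarrow> ('o \<Rightarrow> real) \<Rightarrow> ('o \<Rightarrow> real) \<Rightarrow> bool" where
  "sd_dominates M r p q \<longleftrightarrow>
     (\<forall>x\<in>M. (\<Sum>y\<in>upper_set M r x. p y) \<ge> (\<Sum>y\<in>upper_set M r x. q y))"

definition sd_EF ::
    "nat \<Rightarrow> 'o set \<Rightarrow> (nat \<Rightarrow> 'o rel) \<Rightarrow> (nat \<Rightarrow> 'o \<Rightarrow> real) \<Rightarrow> bool" where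
  "sd_EF n M R P \<longleftrightarrow> (\<forall>j\<in>{1..n}. \<forall>k\<in>{1..n}. sd_dominates M (R j) (P j) (P k))"

text \<open>
  A mechanism is a single map defined for all sizes, item sets and profiles at once; its values off
  actual problems and profiles are irrelevant. Problems of every size exist iff \<open>'o\<close> is infinite.
\<close>

type_synonym 'o assignment_rule = "nat \<Rightarrow> 'o set \<Rightarrow> (nat \<Rightarrow> 'o rel) \<Rightarrow> nat \<Rightarrow> 'o \<Rightarrow> real"

definition satisfies ::
    "'o assignment_rule \<Rightarrow>
     (nat \<Rightarrow> 'o set \<Rightarrow> (nat \<Rightarrow> 'o rel) \<Rightarrow> (nat \<Rightarrow> 'o \<Rightarrow> real) \<Rightarrow> bool) \<Rightarrow> bool" where
  "satisfies f Q \<longleftrightarrow>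
     (\<forall>n M. assignment_problem n M \<longrightarrow>
        (\<forall>R\<in>preference_profiles n M. Q n M R (f n M R)))"

definition mechanism :: "'o assignment_rule \<Rightarrow> bool" where
  "mechanism f \<longleftrightarrow> satisfies f (\<lambda>n M R P. random_assignment n M P)"

end

theory Submission
  imports Defs
begin

text \<open>
  Three agents suffice: let two of them rank \<open>a \<succ> b \<succ> c\<close> and the third \<open>b \<succ> a \<succ> c\<close>. The third
  agent is the only one eager for \<open>b\<close> in the first round, so ea-FERI gives it all of \<open>b\<close>. The other
  two then get nothing of \<open>b\<close>, and not envying the third on the upper set \<open>{a, b}\<close> would require each
  of them to get all of \<open>a\<close>.
\<close>

text \<open>Asymmetry, obtained from transitivity and irreflexivity, leaves at most one best
  element, so the description in \<open>top_item\<close> is determined.\<close>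

lemma top_item_eq:
  assumes "strict_linear_order_on M r" "x \<in> S" "\<And>y. y \<in> S \<Longrightarrow> y \<noteq> x \<Longrightarrow> (x, y) \<in> r"
  shows "top_item r S = x"
  unfolding top_item_def
proof (rule the_equality)
  fix z
  assume z: "z \<in> S \<and> (\<forall>y\<in>S. y \<noteq> z \<longrightarrow> (z, y) \<in> r)"
  show "z = x"
  proof (rule ccontr)
    assume "z \<noteq> x"
    then have "(x, z) \<in> r" "(z, x) \<in> r"
      using z assms(2,3) by auto
    then have "(x, x) \<in> r"
      using assms(1) by (auto simp: strict_linear_order_on_def dest: transD)
    then show False
      using assms(1) by (auto simp: strict_linear_order_on_def irrefl_def)
  qed
qed (use assms in auto)

lemma remaining_items_1: "remaining_items n M R P 1 = M"
  by auto

text \<open>In round 1 only \<open>j\<close> is eager for \<open>x\<close>. Were its share below 1,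
  \<open>x\<close> would still remain in round 2, and ea-FERI would demand total probability 1 on
  the upper set of \<open>x\<close>, which is \<open>{x}\<close> itself. The bound needs no
  assumption that \<open>P\<close> is doubly stochastic.\<close>

lemma ea_FERI_sole_top_item:
  assumes "ea_FERI n M R P" "x \<in> M" "upper_set M (R j) x = {x}"
    and sole: "{k \<in> {1..n}. x = top_item (R k) M} = {j}"
  shows "P j x \<ge> 1"
proof (rule ccontr)
  assume "\<not> P j x \<ge> 1"
  \<comment> \<open>No item remains in round 0, so the union over rounds below 2 reduces to round
    1.\<close>
  have E0: "eager_agents n M R P 0 x = {}"
    by simp
  have E1: "eager_agents n M R P 1 x = {j}"
    using \<open>x \<in> M\<close> sole unfolding eager_agents.simps remaining_items_1 by simp
  have "(\<Union>r'\<in>{..<2}. eager_agents n M R P r' x) = {j}"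
    using E0 E1 by (simp add: lessThan_Suc numeral_2_eq_2 del: eager_agents.simps)
  then have "x \<in> remaining_items n M R P 2"
    using \<open>x \<in> M\<close> \<open>\<not> P j x \<ge> 1\<close>
    by (simp add: numeral_2_eq_2 del: eager_agents.simps)
  moreover have "j \<in> {1..n}"
    using sole by blast
  moreover have "\<exists>r'<2. j \<in> eager_agents n M R P r' x"
    using E1 by (intro exI[of _ 1]) simp
  ultimately have "(\<Sum>y\<in>upper_set M (R j) x. P j y) = 1"
    using assms(1)[unfolded ea_FERI_def, rule_format, of 2 x j] by simp
  with assms(3) \<open>\<not> P j x \<ge> 1\<close> show False
    by simp
qed

definition ranking3 :: "'o \<Rightarrow> 'o \<Rightarrow> 'o \<Rightarrow> 'o rel" where
  "ranking3 x y z = {(x, y), (y, z), (x, z)}"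

lemma strict_linear_order_on_ranking3:
  assumes "distinct [x, y, z]" "M = {x, y, z}"
  shows "strict_linear_order_on M (ranking3 x y z)"
  using assms
  by (auto simp: strict_linear_order_on_def ranking3_def trans_def irrefl_def total_on_def)

lemma upper_set_ranking3:
  assumes "distinct [x, y, z]" "M = {x, y, z}"
  shows "upper_set M (ranking3 x y z) x = {x}" "upper_set M (ranking3 x y z) y = {x, y}"
  using assms by (auto simp: upper_set_def ranking3_def)

lemma top_item_ranking3:
  assumes "distinct [x, y, z]" "M = {x, y, z}"
  shows "top_item (ranking3 x y z) M = x"
  by (rule top_item_eq[OF strict_linear_order_on_ranking3[OF assms]])
    (use assms in \<open>auto simp: ranking3_def\<close>)

lemma ea_FERI_sd_EF_incompatible:
  assumes abc: "distinct [a, b, c]" and M: "M = {a, b, c}"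
    and R: "R 1 = ranking3 a b c" "R 2 = ranking3 a b c" "R 3 = ranking3 b a c"
    and P: "random_assignment 3 M P" "ea_FERI 3 M R P" "sd_EF 3 M R P"
  shows False
proof -
  have bac: "distinct [b, a, c]" "M = {b, a, c}"
    using abc M by auto
  have agents: "{1..3} = {1, 2, 3 :: nat}"
    by auto
  have "{k \<in> {1..3}. b = top_item (R k) M} = {3}"
    using abc R top_item_ranking3[OF abc M] top_item_ranking3[OF bac] unfolding agents by force
  moreover have "upper_set M (R 3) b = {b}"
    using upper_set_ranking3(1)[OF bac] R by simp
  ultimately have b3: "P 3 b \<ge> 1"
    using ea_FERI_sole_top_item[OF P(2)] M by blast
  have nonneg: "P j x \<ge> 0" if "j \<in> {1, 2, 3}" "x \<in> M" for j x
    using P(1) that unfolding random_assignment_def agents by blast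
  have column: "P 1 x + P 2 x + P 3 x = 1" if "x \<in> M" for x
    using P(1) that unfolding random_assignment_def agents by (simp add: add.assoc)
  have no_envy: "P j a + P j b \<ge> P 3 a + P 3 b" if "j \<in> {1, 2}" for j
  proof -
    have "sd_dominates M (R j) (P j) (P 3)"
      using P(3) that unfolding sd_EF_def agents by blast
    then have "sum (P j) (upper_set M (R j) b) \<ge> sum (P 3) (upper_set M (R j) b)"
      using M by (auto simp: sd_dominates_def)
    moreover have "upper_set M (R j) b = {a, b}"
      using that R upper_set_ranking3(2)[OF abc M] by auto
    ultimately show ?thesis
      using abc by simp
  qed
  \<comment> \<open>Column \<open>b\<close> leaves agents 1 and 2 nothing of \<open>b\<close>, so
    \<open>no_envy\<close> forces \<open>P 1 a \<ge> 1\<close> and \<open>P 2 a \<ge> 1\<close>;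
    column \<open>a\<close> would then sum to at least 2.\<close>
  show False
    using b3 nonneg[of 1 b] nonneg[of 2 b] nonneg[of 3 a] column[of a] column[of b]
      no_envy[of 1] no_envy[of 2] M
    by simp
qed

theorem proposition5:
  assumes "infinite (UNIV :: 'o set)"
  shows "\<not> (\<exists>f :: 'o assignment_rule. mechanism f \<and> satisfies f ea_FERI \<and> satisfies f sd_EF)"
proof
  assume "\<exists>f :: 'o assignment_rule. mechanism f \<and> satisfies f ea_FERI \<and> satisfies f sd_EF"
  then obtain f :: "'o assignment_rule"
    where f: "mechanism f" "satisfies f ea_FERI" "satisfies f sd_EF"
    by blast
  \<comment> \<open>Infinity of the item type enters here, to supply three distinct items.\<close>
  obtain M :: "'o set" where card: "card M = 3" and "finite M"
    using infinite_arbitrarily_large[OF assms] by blast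
  then obtain a b c where M: "M = {a, b, c}" and abc: "distinct [a, b, c]"
    by (auto simp: card_3_iff)
  \<comment> \<open>The restricted abstraction makes \<open>R\<close> \<open>undefined\<close> off
    \<open>{1..3}\<close>, as membership in the extensional function space requires.\<close>
  define R where "R = (\<lambda>j\<in>{1..3 :: nat}. if j = 3 then ranking3 b a c else ranking3 a b c)"
  have "assignment_problem 3 M"
    using card \<open>finite M\<close> by (simp add: assignment_problem_def)
  moreover have "R \<in> preference_profiles 3 M"
  proof -
    have "strict_linear_order_on M (ranking3 b a c)" "strict_linear_order_on M (ranking3 a b c)"
      using M abc by (auto intro!: strict_linear_order_on_ranking3)
    moreover have "ranking3 b a c \<subseteq> M \<times> M" "ranking3 a b c \<subseteq> M \<times> M"
      using M by (auto simp: ranking3_def)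
    ultimately show ?thesis
      by (auto simp: preference_profiles_def R_def)
  qed
  ultimately have "random_assignment 3 M (f 3 M R)" "ea_FERI 3 M R (f 3 M R)"
    "sd_EF 3 M R (f 3 M R)"
    using f unfolding mechanism_def satisfies_def by blast+
  then show False
    by (intro ea_FERI_sd_EF_incompatible[OF abc M]) (auto simp: R_def)
qed

end
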